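(* Let $\phi_1,\phi_2\in\mathrm{Dom}(\mathcal{D}^{-1})$ and write $\mathcal{W}_{\phi}(\mathcal{H})=\{\mathcal{W}_\phi\psi:\psi\in\mathcal{H}\}$, where $\mathcal{W}_\phi\psi(x)=\langle\psi,\pi(x)^*\phi\rangle_{\mathcal{H}}$ for $x\in G$. If there exists $c\in\mathbb{C}$ such that $\phi_1=c\phi_2$, then $\mathcal{W}_{\phi_1}(\mathcal{H})=\mathcal{W}_{\phi_2}(\mathcal{H})$. Otherwise, $\mathcal{W}_{\phi_1}(\mathcal{H})\cap\mathcal{W}_{\phi_2}(\mathcal{H})=\{0\}$.
   Context: $G$ is a connected exponential Lie group with Lie algebra $\mathfrak{g}$ ($\exp:\mathfrak{g}\to G$ is a diffeomorphism, with inverse $\log$). The co-adjoint map $K$ is $\langle K(g)Y,X\rangle=\langle Y,\mathrm{Ad}_{g^{-1}}X\rangle$ for $Y\in\mathfrak g^*$. Fix $F\in\mathfrak{g}^*$ with trivial stabilizer $\{g\in G:K(g)F=F\}=\{e\}$. $(\pi,\mathcal{H})$ is the irreducible unitary representation attached to the orbit $\mathcal{O}_F=K(G)F$ by the Kirillov orbit method: $\pi=\mathrm{ind}_H^G\chi_F$ (unitary induction), where $H$ is a closed subgroup of maximal dimension whose Lie algebra $\mathfrak{h}$ satisfies $\langle F,[\mathfrak{h},\mathfrak{h}]\rangle=0$, and $\chi_F(h)=e^{-2\pi i\langle F,\log h\rangle}$ for $h\in H$; it is square integrable. $\mu_r$ is a right Haar measure and $L^2_r(G)=L^2(G,\mu_r)$.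 Inner products are linear in the first variable. The Duflo-Moore operator $\mathcal{D}^{-1}$ is the unique positive densely defined operator on $\mathcal{H}$ with $\langle \mathcal{W}_{\phi_1}\psi_1,\mathcal{W}_{\phi_2}\psi_2\rangle_{L^2_r}=\langle\psi_1,\psi_2\rangle\overline{\langle\mathcal{D}^{-1}\phi_1,\mathcal{D}^{-1}\phi_2\rangle}$ for $\phi_i\in\mathrm{Dom}(\mathcal{D}^{-1})$, $\psi_i\in\mathcal H$.
   Formalization: The scalar c is required to be nonzero, in both the first case and the "otherwise"; with c = 0 allowed the claim fails for φ₁ = 0, φ₂ ≠ 0, where W_{φ₁}(H) = {0} but W_{φ₂}(H) ≠ {0}; that pair now falls under "otherwise". *)

theory Defs
  imports "HOL-Analysis.Analysis" "HOL-Algebra.Group"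
begin

section \<open>Complex Hilbert spaces\<close>

class complex_hilbert = banach +
  fixes scaleC :: "complex \<Rightarrow> 'a \<Rightarrow> 'a" (infixr "*\<^sub>C" 75)
    and cinner :: "'a \<Rightarrow> 'a \<Rightarrow> complex"
  assumes scaleC_add_right: "a *\<^sub>C (x + y) = a *\<^sub>C x + a *\<^sub>C y"
    and scaleC_add_left: "(a + b) *\<^sub>C x = a *\<^sub>C x + b *\<^sub>C x"
    and scaleC_scaleC: "a *\<^sub>C (b *\<^sub>C x) = (a * b) *\<^sub>C x"
    and scaleR_scaleC: "r *\<^sub>R x = complex_of_real r *\<^sub>C x"
    and cinner_add_left: "cinner (x + y) z = cinner x z + cinner y z"
    and cinner_scaleC_left: "cinner (a *\<^sub>C x) y = a * cinner x y"
    and cinner_commute: "cinner x y = cnj (cinner y x)"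
    and cinner_self: "cinner x x = complex_of_real ((norm x)\<^sup>2)"

definition csubspace :: "'h::complex_hilbert set \<Rightarrow> bool" where
  "csubspace M \<longleftrightarrow>
     0 \<in> M \<and> (\<forall>x\<in>M. \<forall>y\<in>M. x + y \<in> M) \<and> (\<forall>a. \<forall>x\<in>M. a *\<^sub>C x \<in> M)"

definition clinear_on :: "'h::complex_hilbert set \<Rightarrow> ('h \<Rightarrow> 'h) \<Rightarrow> bool" where
  "clinear_on M T \<longleftrightarrow>
     (\<forall>x\<in>M. \<forall>y\<in>M. T (x + y) = T x + T y) \<and> (\<forall>a. \<forall>x\<in>M. T (a *\<^sub>C x) = a *\<^sub>C T x)"

text \<open>Meaningful for bounded operators, which have exactly one adjoint.\<close>

definition cadjoint :: "('h::complex_hilbert \<Rightarrow> 'h) \<Rightarrow> 'h \<Rightarrow> 'h" where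
  "cadjoint A = (THE B. \<forall>u v. cinner (A u) v = cinner u (B v))"


section \<open>Lie groups\<close>

text \<open>Smoothness is only applied to open sets. There the derivative is determined by the
  function, and iterated directional derivatives suffice because the spaces involved are
  finite-dimensional.\<close>

primrec Ck_on :: "nat \<Rightarrow> 'a::real_normed_vector set \<Rightarrow> ('a \<Rightarrow> 'b::real_normed_vector) \<Rightarrow> bool" where
  "Ck_on 0 S f \<longleftrightarrow> continuous_on S f"
| "Ck_on (Suc k) S f \<longleftrightarrow>
     (\<exists>f'. (\<forall>x\<in>S. (f has_derivative f' x) (at x)) \<and> (\<forall>v. Ck_on k S (\<lambda>x. f' x v)))"

definition smooth_on :: "'a::real_normed_vector set \<Rightarrow> ('a \<Rightarrow> 'b::real_normed_vector) \<Rightarrow> bool" where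
  "smooth_on S f \<longleftrightarrow> (\<forall>k. Ck_on k S f)"

text \<open>The type \<open>'b\<close> serves as the model space of the charts and as the vector space underlying
  the Lie algebra; \<open>lfield G X\<close> is the left-invariant vector field, acting on functions, that
  belongs to \<open>X :: 'b\<close>.\<close>

record ('a, 'b) lie_group_data = "'a monoid" +
  atlas :: "('a set \<times> ('a \<Rightarrow> 'b)) set"
  lfield :: "'b \<Rightarrow> ('a \<Rightarrow> real) \<Rightarrow> 'a \<Rightarrow> real"

definition smooth_functions :: "('a, 'b::real_normed_vector, 'm) lie_group_data_scheme \<Rightarrow> ('a \<Rightarrow> real) set" where
  "smooth_functions G =
     {f. \<forall>(U, \<kappa>)\<in>atlas G. smooth_on (\<kappa> ` U) (\<lambda>a. f (inv_into U \<kappa> a))}"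

text \<open>Left-invariant vector fields, as derivations of the algebra of smooth functions that
  commute with left translations. Values off \<^const>\<open>smooth_functions\<close> are irrelevant.\<close>

definition left_invariant_field ::
  "('a, 'b::real_normed_vector, 'm) lie_group_data_scheme \<Rightarrow> (('a \<Rightarrow> real) \<Rightarrow> 'a \<Rightarrow> real) \<Rightarrow> bool" where
  "left_invariant_field G D \<longleftrightarrow>
     (\<forall>f\<in>smooth_functions G. D f \<in> smooth_functions G) \<and>
     (\<forall>f\<in>smooth_functions G. \<forall>h\<in>smooth_functions G. \<forall>r s.
        D (\<lambda>x. r * f x + s * h x) = (\<lambda>x. r * D f x + s * D h x)) \<and>
     (\<forall>f\<in>smooth_functions G. \<forall>h\<in>smooth_functions G.
        D (\<lambda>x. f x * h x) = (\<lambda>x. f x * D h x + D f x * h x)) \<and>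
     (\<forall>f\<in>smooth_functions G. \<forall>a\<in>carrier G.
        D (\<lambda>x. f (a \<otimes>\<^bsub>G\<^esub> x)) = (\<lambda>x. D f (a \<otimes>\<^bsub>G\<^esub> x)))"

locale lie_group = group G
  for G :: "('a::{t2_space, second_countable_topology}, 'b::real_normed_vector, 'm)
              lie_group_data_scheme" (structure) +
  assumes finite_dim: "\<exists>B::'b set. finite B \<and> span B = UNIV"
    and carrier_UNIV: "carrier G = UNIV"
    and chart: "(U, \<kappa>) \<in> atlas G \<Longrightarrow>
      open U \<and> open (\<kappa> ` U) \<and> homeomorphism U (\<kappa> ` U) \<kappa> (inv_into U \<kappa>)"
    and charts_cover: "(\<Union>(U, \<kappa>)\<in>atlas G. U) = UNIV"
    and charts_compatible: "(U, \<kappa>) \<in> atlas G \<Longrightarrow> (V, \<eta>) \<in> atlas G \<Longrightarrow>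
      smooth_on (\<kappa> ` (U \<inter> V)) (\<lambda>a. \<eta> (inv_into U \<kappa> a))"
    and mult_continuous: "continuous_on UNIV (\<lambda>(x, y). x \<otimes> y)"
    and mult_smooth: "(U, \<kappa>) \<in> atlas G \<Longrightarrow> (V, \<eta>) \<in> atlas G \<Longrightarrow> (W, \<theta>) \<in> atlas G \<Longrightarrow>
      smooth_on {(a, b). a \<in> \<kappa> ` U \<and> b \<in> \<eta> ` V \<and> inv_into U \<kappa> a \<otimes> inv_into V \<eta> b \<in> W}
                (\<lambda>(a, b). \<theta> (inv_into U \<kappa> a \<otimes> inv_into V \<eta> b))"
    and inv_continuous: "continuous_on UNIV (\<lambda>x. inv x)"
    and inv_smooth: "(U, \<kappa>) \<in> atlas G \<Longrightarrow> (W, \<theta>) \<in> atlas G \<Longrightarrow>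
      smooth_on {a. a \<in> \<kappa> ` U \<and> inv (inv_into U \<kappa> a) \<in> W} (\<lambda>a. \<theta> (inv (inv_into U \<kappa> a)))"
    and lfield_left_invariant: "left_invariant_field G (lfield G X)"
    and lfield_linear: "f \<in> smooth_functions G \<Longrightarrow>
      lfield G (r *\<^sub>R X + s *\<^sub>R Y) f = (\<lambda>x. r * lfield G X f x + s * lfield G Y f x)"
    and lfield_bij: "left_invariant_field G D \<Longrightarrow>
      \<exists>!X. \<forall>f\<in>smooth_functions G. lfield G X f = D f"

definition lie_bracket :: "('a, 'b::real_normed_vector, 'm) lie_group_data_scheme \<Rightarrow> 'b \<Rightarrow> 'b \<Rightarrow> 'b" where
  "lie_bracket G X Y = (THE Z. \<forall>f\<in>smooth_functions G.
     lfield G Z f = (\<lambda>x. lfield G X (lfield G Y f) x - lfield G Y (lfield G X f) x))"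

definition one_parameter_subgroup ::
  "('a, 'b::real_normed_vector, 'm) lie_group_data_scheme \<Rightarrow> 'b \<Rightarrow> (real \<Rightarrow> 'a) \<Rightarrow> bool" where
  "one_parameter_subgroup G X \<gamma> \<longleftrightarrow>
     (\<forall>s t. \<gamma> (s + t) = \<gamma> s \<otimes>\<^bsub>G\<^esub> \<gamma> t) \<and>
     (\<forall>f\<in>smooth_functions G. \<forall>t.
        ((\<lambda>u. f (\<gamma> u)) has_real_derivative lfield G X f (\<gamma> t)) (at t))"

definition lie_exp :: "('a, 'b::real_normed_vector, 'm) lie_group_data_scheme \<Rightarrow> 'b \<Rightarrow> 'a" where
  "lie_exp G X = (THE x. \<exists>\<gamma>. one_parameter_subgroup G X \<gamma> \<and> x = \<gamma> 1)"

definition lie_log :: "('a, 'b::real_normed_vector, 'm) lie_group_data_scheme \<Rightarrow> 'a \<Rightarrow> 'b" where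
  "lie_log G = inv_into UNIV (lie_exp G)"

text \<open>\<open>Ad\<^sub>g\<close> is the differential at the identity of conjugation by \<open>g\<close>; tangent vectors at the
  identity are given by their action on smooth functions.\<close>

definition Ad :: "('a, 'b::real_normed_vector, 'm) lie_group_data_scheme \<Rightarrow> 'a \<Rightarrow> 'b \<Rightarrow> 'b" where
  "Ad G g X = (THE Y. \<forall>f\<in>smooth_functions G.
     ((\<lambda>t. f (g \<otimes>\<^bsub>G\<^esub> lie_exp G (t *\<^sub>R X) \<otimes>\<^bsub>G\<^esub> inv\<^bsub>G\<^esub> g))
        has_real_derivative lfield G Y f \<one>\<^bsub>G\<^esub>) (at 0))"

text \<open>Elements of the dual of the Lie algebra are linear functions \<open>'b \<Rightarrow> real\<close>.\<close>

definition coadjoint ::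
  "('a, 'b::real_normed_vector, 'm) lie_group_data_scheme \<Rightarrow> 'a \<Rightarrow> ('b \<Rightarrow> real) \<Rightarrow> 'b \<Rightarrow> real" where
  "coadjoint G g Y = (\<lambda>X. Y (Ad G (inv\<^bsub>G\<^esub> g) X))"

definition coadjoint_stabilizer ::
  "('a, 'b::real_normed_vector, 'm) lie_group_data_scheme \<Rightarrow> ('b \<Rightarrow> real) \<Rightarrow> 'a set" where
  "coadjoint_stabilizer G F = {g \<in> carrier G. coadjoint G g F = F}"

locale connected_exponential_lie_group = lie_group G
  for G :: "('a::{t2_space, second_countable_topology}, 'b::real_normed_vector, 'm)
              lie_group_data_scheme" (structure) +
  assumes connected_carrier: "connected (carrier G)"
    and exp_bij: "bij (lie_exp G)"
    and exp_continuous: "continuous_on UNIV (lie_exp G)"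
    and exp_smooth: "(U, \<kappa>) \<in> atlas G \<Longrightarrow>
      smooth_on (lie_exp G -` U) (\<lambda>X. \<kappa> (lie_exp G X))"
    and log_smooth: "(U, \<kappa>) \<in> atlas G \<Longrightarrow>
      smooth_on (\<kappa> ` U) (\<lambda>a. lie_log G (inv_into U \<kappa> a))"


section \<open>Haar measures\<close>

text \<open>Haar measures on a closed subgroup \<open>H\<close> of \<open>G\<close> (possibly \<open>G\<close> itself). Regularity is automatic,
  since the groups considered are locally compact and second countable.\<close>

definition right_haar_measure ::
  "('a::topological_space, 'm) monoid_scheme \<Rightarrow> 'a set \<Rightarrow> 'a measure \<Rightarrow> bool" where
  "right_haar_measure G H M \<longleftrightarrow>
     space M = H \<and> sets M = sets (restrict_space borel H) \<and>
     emeasure M H \<noteq> 0 \<and>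
     (\<forall>K. compact K \<and> K \<subseteq> H \<longrightarrow> emeasure M K < \<infinity>) \<and>
     (\<forall>h\<in>H. \<forall>A\<in>sets M. emeasure M ((\<lambda>x. x \<otimes>\<^bsub>G\<^esub> h) ` A) = emeasure M A)"

text \<open>For a right Haar measure \<open>M\<close>, \<open>M (h A) = left_modulus G M h * M A\<close>. This is the reciprocal of
  the modular function \<open>\<Delta>\<close> defined by \<open>\<lambda> (A h) = \<Delta> h * \<lambda> A\<close> for a left Haar measure \<open>\<lambda>\<close>.\<close>

definition left_modulus :: "('a, 'm) monoid_scheme \<Rightarrow> 'a measure \<Rightarrow> 'a \<Rightarrow> real" where
  "left_modulus G M h = (THE c. 0 < c \<and>
     (\<forall>A\<in>sets M. emeasure M ((\<lambda>x. h \<otimes>\<^bsub>G\<^esub> x) ` A) = ennreal c * emeasure M A))"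


section \<open>Unitary representations\<close>

definition unitary_representation ::
  "('a::topological_space, 'm) monoid_scheme \<Rightarrow> ('a \<Rightarrow> 'h::complex_hilbert \<Rightarrow> 'h) \<Rightarrow> bool" where
  "unitary_representation G \<pi> \<longleftrightarrow>
     (\<forall>x\<in>carrier G. clinear_on UNIV (\<pi> x) \<and> surj (\<pi> x) \<and>
        (\<forall>u v. cinner (\<pi> x u) (\<pi> x v) = cinner u v)) \<and>
     \<pi> \<one>\<^bsub>G\<^esub> = id \<and>
     (\<forall>x\<in>carrier G. \<forall>y\<in>carrier G. \<pi> (x \<otimes>\<^bsub>G\<^esub> y) = \<pi> x \<circ> \<pi> y) \<and>
     (\<forall>u. continuous_on (carrier G) (\<lambda>x. \<pi> x u))"

definition irreducible_representation ::
  "('a, 'm) monoid_scheme \<Rightarrow> ('a \<Rightarrow> 'h::complex_hilbert \<Rightarrow> 'h) \<Rightarrow> bool" where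
  "irreducible_representation G \<pi> \<longleftrightarrow>
     (UNIV :: 'h set) \<noteq> {0} \<and>
     (\<forall>M. csubspace M \<and> closed M \<and> (\<forall>x\<in>carrier G. \<pi> x ` M \<subseteq> M) \<longrightarrow> M = {0} \<or> M = UNIV)"

definition wavelet ::
  "('a \<Rightarrow> 'h::complex_hilbert \<Rightarrow> 'h) \<Rightarrow> 'h \<Rightarrow> 'h \<Rightarrow> 'a \<Rightarrow> complex" where
  "wavelet \<pi> \<phi> \<psi> = (\<lambda>x. cinner \<psi> (cadjoint (\<pi> x) \<phi>))"

definition in_L2 :: "'a measure \<Rightarrow> ('a \<Rightarrow> complex) \<Rightarrow> bool" where
  "in_L2 M f \<longleftrightarrow> f \<in> borel_measurable M \<and> integrable M (\<lambda>x. (cmod (f x))\<^sup>2)"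

definition L2_inner :: "'a measure \<Rightarrow> ('a \<Rightarrow> complex) \<Rightarrow> ('a \<Rightarrow> complex) \<Rightarrow> complex" where
  "L2_inner M f g = (LINT x|M. f x * cnj (g x))"

definition square_integrable_representation ::
  "'a measure \<Rightarrow> ('a \<Rightarrow> 'h::complex_hilbert \<Rightarrow> 'h) \<Rightarrow> bool" where
  "square_integrable_representation \<mu> \<pi> \<longleftrightarrow> (\<exists>\<phi>. \<phi> \<noteq> 0 \<and> in_L2 \<mu> (wavelet \<pi> \<phi> \<phi>))"


section \<open>Unitary induction\<close>

text \<open>The representation of \<open>G\<close> unitarily induced from a unitary character \<open>chi\<close> of a closed subgroup
  \<open>H\<close> acts by right translation on Borel functions \<open>f\<close> with
  \<open>f (h g) = chi h * sqrt (\<Delta>\<^sub>G h / \<Delta>\<^sub>H h) * f g\<close>; the square root makes it unitary, and with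
  \<^const>\<open>left_modulus\<close> the quotient of modular functions appears inverted.
  The integral over the space of cosets \<open>H g\<close> is written as an integral over \<open>G\<close> against a Borel weight
  \<open>w\<close> of total \<open>\<eta>\<close>-mass 1 on each coset \<open>H g\<close>. For functions \<open>p\<close> with
  \<open>p (h g) = (\<Delta>\<^sub>G h / \<Delta>\<^sub>H h) * p g\<close>, the integral of \<open>p * w\<close> against \<open>\<mu>\<close> does not depend on \<open>w\<close>, and is
  invariant under right translations of \<open>p\<close>.\<close>

definition coset_weight ::
  "('a::topological_space, 'm) monoid_scheme \<Rightarrow> 'a measure \<Rightarrow> ('a \<Rightarrow> real) \<Rightarrow> bool" where
  "coset_weight G \<eta> w \<longleftrightarrow>
     w \<in> borel_measurable borel \<and> (\<forall>g. 0 \<le> w g) \<and>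
     (\<forall>g\<in>carrier G. (\<integral>\<^sup>+ h. ennreal (w (h \<otimes>\<^bsub>G\<^esub> g)) \<partial>\<eta>) = 1)"

definition induced_inner ::
  "'a measure \<Rightarrow> ('a \<Rightarrow> real) \<Rightarrow> ('a \<Rightarrow> complex) \<Rightarrow> ('a \<Rightarrow> complex) \<Rightarrow> complex" where
  "induced_inner \<mu> w f1 f2 = (LINT g|\<mu>. f1 g * cnj (f2 g) * complex_of_real (w g))"

definition induced_space ::
  "('a::topological_space, 'm) monoid_scheme \<Rightarrow> 'a measure \<Rightarrow> 'a set \<Rightarrow> 'a measure \<Rightarrow> ('a \<Rightarrow> real)
     \<Rightarrow> ('a \<Rightarrow> complex) \<Rightarrow> ('a \<Rightarrow> complex) set" where
  "induced_space G \<mu> H \<eta> w chi =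
     {f. f \<in> borel_measurable borel \<and>
        (\<forall>h\<in>H. \<forall>g\<in>carrier G. f (h \<otimes>\<^bsub>G\<^esub> g) =
           chi h * complex_of_real (sqrt (left_modulus G \<eta> h / left_modulus G \<mu> h)) * f g) \<and>
        integrable \<mu> (\<lambda>g. (cmod (f g))\<^sup>2 * w g)}"

text \<open>Elements of the induced Hilbert space are functions up to equality almost everywhere. The
  choice of \<open>\<eta>\<close> and \<open>w\<close> is immaterial up to unitary equivalence.\<close>

definition is_induced_representation ::
  "('a::topological_space, 'm) monoid_scheme \<Rightarrow> 'a measure \<Rightarrow> 'a set \<Rightarrow> ('a \<Rightarrow> complex)
     \<Rightarrow> ('a \<Rightarrow> 'h::complex_hilbert \<Rightarrow> 'h) \<Rightarrow> bool" where
  "is_induced_representation G \<mu> H chi \<pi> \<longleftrightarrow>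
     (\<exists>\<eta> w. right_haar_measure G H \<eta> \<and> coset_weight G \<eta> w \<and>
       (\<exists>U :: 'h \<Rightarrow> 'a \<Rightarrow> complex.
          (\<forall>u. U u \<in> induced_space G \<mu> H \<eta> w chi) \<and>
          (\<forall>u v a b. AE g in \<mu>. U (a *\<^sub>C u + b *\<^sub>C v) g = a * U u g + b * U v g) \<and>
          (\<forall>u v. induced_inner \<mu> w (U u) (U v) = cinner u v) \<and>
          (\<forall>f\<in>induced_space G \<mu> H \<eta> w chi. \<exists>u. AE g in \<mu>. U u g = f g) \<and>
          (\<forall>x\<in>carrier G. \<forall>u. AE g in \<mu>. U (\<pi> x u) g = U u (g \<otimes>\<^bsub>G\<^esub> x))))"


section \<open>The orbit method\<close>

definition lie_algebra_of ::
  "('a, 'b::real_normed_vector, 'm) lie_group_data_scheme \<Rightarrow> 'a set \<Rightarrow> 'b set" where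
  "lie_algebra_of G H = {X. \<forall>t::real. lie_exp G (t *\<^sub>R X) \<in> H}"

definition isotropic_subgroup ::
  "('a::topological_space, 'b::real_normed_vector, 'm) lie_group_data_scheme \<Rightarrow> ('b \<Rightarrow> real) \<Rightarrow> 'a set \<Rightarrow> bool" where
  "isotropic_subgroup G F H \<longleftrightarrow> subgroup H G \<and> closed H \<and>
     (\<forall>X\<in>lie_algebra_of G H. \<forall>Y\<in>lie_algebra_of G H. F (lie_bracket G X Y) = 0)"

definition polarizing_subgroup ::
  "('a::topological_space, 'b::real_normed_vector, 'm) lie_group_data_scheme \<Rightarrow> ('b \<Rightarrow> real) \<Rightarrow> 'a set \<Rightarrow> bool" where
  "polarizing_subgroup G F H \<longleftrightarrow> isotropic_subgroup G F H \<and>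
     (\<forall>H'. isotropic_subgroup G F H' \<longrightarrow> dim (lie_algebra_of G H') \<le> dim (lie_algebra_of G H))"

definition orbit_character ::
  "('a, 'b::real_normed_vector, 'm) lie_group_data_scheme \<Rightarrow> ('b \<Rightarrow> real) \<Rightarrow> 'a \<Rightarrow> complex" where
  "orbit_character G F h = exp (- 2 * complex_of_real pi * \<i> * complex_of_real (F (lie_log G h)))"

text \<open>Representations are considered up to unitary equivalence. Irreducibility is part of the
  definition: for an exponential group that is not nilpotent, maximal dimension of \<open>H\<close> alone does
  not guarantee it (Pukanszky's condition).\<close>

definition orbit_representation ::
  "('a::topological_space, 'b::real_normed_vector, 'm) lie_group_data_scheme \<Rightarrow> 'a measure \<Rightarrow> ('b \<Rightarrow> real)
     \<Rightarrow> ('a \<Rightarrow> 'h::complex_hilbert \<Rightarrow> 'h) \<Rightarrow> bool" where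
  "orbit_representation G \<mu> F \<pi> \<longleftrightarrow>
     unitary_representation G \<pi> \<and> irreducible_representation G \<pi> \<and>
     (\<exists>H. polarizing_subgroup G F H \<and> is_induced_representation G \<mu> H (orbit_character G F) \<pi>)"


section \<open>The Duflo-Moore operator\<close>

text \<open>An operator \<open>T\<close> with domain \<open>Dom\<close> (values of \<open>T\<close> outside \<open>Dom\<close> are irrelevant) having the
  defining properties of the Duflo-Moore operator. Neither self-adjointness of \<open>T\<close> nor maximality
  of \<open>Dom\<close>, which single out one such operator, is demanded, so a statement about all \<open>T\<close>
  with these properties covers the Duflo-Moore operator.\<close>

definition duflo_moore_operator ::
  "'a measure \<Rightarrow> ('a \<Rightarrow> 'h::complex_hilbert \<Rightarrow> 'h) \<Rightarrow> 'h set \<Rightarrow> ('h \<Rightarrow> 'h) \<Rightarrow> bool" where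
  "duflo_moore_operator \<mu> \<pi> Dom T \<longleftrightarrow>
     csubspace Dom \<and> closure Dom = UNIV \<and> clinear_on Dom T \<and>
     (\<forall>\<phi>\<in>Dom. cinner (T \<phi>) \<phi> \<in> \<real> \<and> 0 \<le> Re (cinner (T \<phi>) \<phi>)) \<and>
     (\<forall>\<phi>\<in>Dom. \<forall>\<psi>. in_L2 \<mu> (wavelet \<pi> \<phi> \<psi>)) \<and>
     (\<forall>\<phi>1\<in>Dom. \<forall>\<phi>2\<in>Dom. \<forall>\<psi>1 \<psi>2.
        L2_inner \<mu> (wavelet \<pi> \<phi>1 \<psi>1) (wavelet \<pi> \<phi>2 \<psi>2) =
        cinner \<psi>1 \<psi>2 * cnj (cinner (T \<phi>1) (T \<phi>2)))"

end

theory Submission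
  imports Defs
begin

text \<open>Suppose \<open>f = \<W>\<^sub>\<phi>\<^sub>1 \<psi>\<^sub>1 = \<W>\<^sub>\<phi>\<^sub>2 \<psi>\<^sub>2\<close> is nonzero. Pairing \<open>f\<close> with \<open>\<W>\<^sub>\<phi>\<^sub>1 \<psi>\<close> for arbitrary \<open>\<psi>\<close> and
  applying the orthogonality relations to both expressions gives
  \<open>\<parallel>T \<phi>\<^sub>1\<parallel>\<^sup>2 \<psi>\<^sub>1 = d \<psi>\<^sub>2\<close> for a scalar \<open>d\<close>. Since \<open>f\<close> is continuous and Haar measure charges
  nonempty open sets, \<open>f\<close> is not null, so \<open>T \<phi>\<^sub>1 \<noteq> 0\<close> and \<open>\<psi>\<^sub>1 = a \<psi>\<^sub>2\<close> with \<open>a \<noteq> 0\<close>. Hence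
  \<open>\<psi>\<^sub>2\<close> has vanishing wavelet transform with respect to \<open>cnj a \<phi>\<^sub>1 - \<phi>\<^sub>2\<close>; as \<open>\<psi>\<^sub>2\<close> is a
  cyclic vector, \<open>\<phi>\<^sub>2 = cnj a \<phi>\<^sub>1\<close>.\<close>

section \<open>Algebra and continuity of the inner product\<close>

lemma cinner_add_right: "cinner x (y + z) = cinner x y + cinner x z"
  for x :: "'h::complex_hilbert"
  by (metis cinner_add_left cinner_commute complex_cnj_add)

lemma cinner_scaleC_right: "cinner x (a *\<^sub>C y) = cnj a * cinner x y"
  for x :: "'h::complex_hilbert"
  by (metis cinner_scaleC_left cinner_commute complex_cnj_mult)

lemma cinner_zero_left [simp]: "cinner 0 x = 0"
  for x :: "'h::complex_hilbert"
  using cinner_add_left[of 0 0 x] by simp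

lemma cinner_zero_right [simp]: "cinner x 0 = 0"
  for x :: "'h::complex_hilbert"
  using cinner_add_right[of x 0 0] by simp

lemma cinner_diff_left: "cinner (x - y) z = cinner x z - cinner y z"
  for x :: "'h::complex_hilbert"
  using cinner_add_left[of "x - y" y z] by simp

lemma cinner_diff_right: "cinner x (y - z) = cinner x y - cinner x z"
  for x :: "'h::complex_hilbert"
  using cinner_add_right[of x "y - z" z] by simp

lemma cinner_self_eq_0 [simp]: "cinner x x = 0 \<longleftrightarrow> x = 0"
  for x :: "'h::complex_hilbert"
  by (simp add: cinner_self)

lemma scaleC_one [simp]: "1 *\<^sub>C x = x"
  for x :: "'h::complex_hilbert"
  using scaleR_scaleC[of 1 x] by simp

lemma scaleC_zero_left [simp]: "0 *\<^sub>C x = 0"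
  for x :: "'h::complex_hilbert"
  using scaleR_scaleC[of 0 x] by simp

lemma cinner_eqI_right:
  fixes y z :: "'h::complex_hilbert"
  assumes "\<And>x. cinner x y = cinner x z"
  shows "y = z"
  using assms[of "y - z"] cinner_diff_right[of "y - z" y z] by simp

lemma cinner_eqI_left:
  fixes y z :: "'h::complex_hilbert"
  assumes "\<And>x. cinner y x = cinner z x"
  shows "y = z"
  using assms[of "y - z"] cinner_diff_left[of y z "y - z"] by simp

text \<open>Expresses the inner product through norms alone, so that its continuity follows from
  that of the norm.\<close>

lemma cinner_polarization:
  fixes x y :: "'h::complex_hilbert"
  shows "cinner x y = Complex (((norm (x + y))\<^sup>2 - (norm (x - y))\<^sup>2) / 4)
    (((norm (x + \<i> *\<^sub>C y))\<^sup>2 - (norm (x - \<i> *\<^sub>C y))\<^sup>2) / 4)"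
proof -
  have re: "Re (cinner x z) = ((norm (x + z))\<^sup>2 - (norm (x - z))\<^sup>2) / 4" for z
  proof -
    have "complex_of_real ((norm (x + z))\<^sup>2 - (norm (x - z))\<^sup>2) =
        cinner (x + z) (x + z) - cinner (x - z) (x - z)"
      by (simp add: cinner_self)
    also have "\<dots> = 2 * (cinner x z + cinner z x)"
      by (simp add: cinner_add_left cinner_add_right cinner_diff_left cinner_diff_right)
    also have "\<dots> = 4 * complex_of_real (Re (cinner x z))"
      by (subst cinner_commute[of z]) (simp add: complex_eq_iff)
    finally have "complex_of_real ((norm (x + z))\<^sup>2 - (norm (x - z))\<^sup>2) =
        complex_of_real (4 * Re (cinner x z))"
      by simp
    then show ?thesis
      unfolding of_real_eq_iff by simp
  qed
  \<comment> \<open>The second variable is conjugate-linear, and the real part of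
    \<open>- \<i> * z\<close> is \<open>Im z\<close>.\<close>
  have "Im (cinner x y) = Re (cinner x (\<i> *\<^sub>C y))"
    by (simp add: cinner_scaleC_right)
  then show ?thesis
    by (simp add: complex_eq_iff re)
qed

lemma continuous_on_cinner_left:
  fixes f :: "'a::topological_space \<Rightarrow> 'h::complex_hilbert"
  assumes "continuous_on S f"
  shows "continuous_on S (\<lambda>x. cinner (f x) y)"
  unfolding cinner_polarization Complex_eq
  by (intro continuous_intros assms) simp_all


section \<open>Unitary representations and their wavelet transforms\<close>

context
  fixes G :: "('a::topological_space, 'm) monoid_scheme" (structure)
    and \<pi> :: "'a \<Rightarrow> 'h::complex_hilbert \<Rightarrow> 'h"
  assumes grp: "group G" and unitary: "unitary_representation G \<pi>"
begin

lemma unitary_repr_add: "x \<in> carrier G \<Longrightarrow> \<pi> x (u + v) = \<pi> x u + \<pi> x v"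
  and unitary_repr_scaleC: "x \<in> carrier G \<Longrightarrow> \<pi> x (a *\<^sub>C u) = a *\<^sub>C \<pi> x u"
  and unitary_repr_cinner: "x \<in> carrier G \<Longrightarrow> cinner (\<pi> x u) (\<pi> x v) = cinner u v"
  and unitary_repr_one: "\<pi> \<one> u = u"
  and unitary_repr_mult:
    "x \<in> carrier G \<Longrightarrow> y \<in> carrier G \<Longrightarrow> \<pi> (x \<otimes> y) u = \<pi> x (\<pi> y u)"
  and unitary_repr_continuous: "continuous_on (carrier G) (\<lambda>x. \<pi> x u)"
  using unitary unfolding unitary_representation_def clinear_on_def by auto

lemma unitary_repr_norm: "x \<in> carrier G \<Longrightarrow> norm (\<pi> x u) = norm u"
  using unitary_repr_cinner[of x u u] unfolding cinner_self of_real_eq_iff by simp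

lemma unitary_repr_zero: "x \<in> carrier G \<Longrightarrow> \<pi> x 0 = 0"
  using unitary_repr_norm[of x 0] by simp

text \<open>Continuity in the vector for a fixed group element, as opposed to strong continuity in
  the group variable: an additive norm-preserving map is an isometry.\<close>

lemma unitary_repr_continuous_vector:
  assumes x: "x \<in> carrier G"
  shows "continuous_on S (\<pi> x)"
proof -
  have "\<pi> x (- u) = - \<pi> x u" for u
    using unitary_repr_add[OF x, of u "- u"] unitary_repr_zero[OF x]
    by (simp add: eq_neg_iff_add_eq_0 add.commute)
  then have "dist (\<pi> x u) (\<pi> x v) = dist u v" for u v
    using unitary_repr_norm[OF x, of "u - v"] unitary_repr_add[OF x, of u "- v"]
    by (simp add: dist_norm)
  then show ?thesis
    unfolding continuous_on_iff by metis
qed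

text \<open>The adjoint is \<open>\<pi> (inv x)\<close>, by unitarity applied to \<open>u\<close>
  and \<open>\<pi> (inv x) v\<close>. Since \<open>cadjoint\<close> is a definite description,
  uniqueness is also required; it comes from nondegeneracy of the inner product.\<close>

lemma cadjoint_unitary_repr:
  assumes x: "x \<in> carrier G"
  shows "cinner u (cadjoint (\<pi> x) v) = cinner (\<pi> x u) v"
proof -
  have inv_x: "inv x \<in> carrier G" "x \<otimes> inv x = \<one>"
    using x grp by (auto simp: group.inv_closed group.r_inv)
  have adj: "cinner (\<pi> x u) v = cinner u (\<pi> (inv x) v)" for u v
    using unitary_repr_cinner[OF x, of u "\<pi> (inv x) v"] unitary_repr_mult[OF x inv_x(1), of v]
    by (simp add: inv_x unitary_repr_one)
  have "cadjoint (\<pi> x) = \<pi> (inv x)"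
    unfolding cadjoint_def
  proof (rule the_equality)
    show "\<forall>u v. cinner (\<pi> x u) v = cinner u (\<pi> (inv x) v)"
      using adj by blast
    show "B = \<pi> (inv x)" if "\<forall>u v. cinner (\<pi> x u) v = cinner u (B v)" for B
      using that adj by (metis ext cinner_eqI_right)
  qed
  then show ?thesis
    by (simp add: adj)
qed

lemma wavelet_eq: "x \<in> carrier G \<Longrightarrow> wavelet \<pi> \<phi> \<psi> x = cinner (\<pi> x \<psi>) \<phi>"
  by (simp add: wavelet_def cadjoint_unitary_repr)

lemma wavelet_continuous: "continuous_on (carrier G) (wavelet \<pi> \<phi> \<psi>)"
proof -
  have "continuous_on (carrier G) (\<lambda>x. cinner (\<pi> x \<psi>) \<phi>)"
    by (intro continuous_on_cinner_left unitary_repr_continuous)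
  then show ?thesis
    by (rule continuous_on_eq) (simp add: wavelet_eq)
qed

text \<open>The vectors whose transform with window \<open>\<phi>\<close> vanishes form a closed
  invariant subspace. It contains \<open>\<psi> \<noteq> 0\<close>, hence is everything, and in
  particular contains \<open>\<phi>\<close> itself.\<close>

lemma irreducible_wavelet_eq_0:
  assumes irred: "irreducible_representation G \<pi>"
    and zero: "\<And>x. x \<in> carrier G \<Longrightarrow> wavelet \<pi> \<phi> \<psi> x = 0" and "\<psi> \<noteq> 0"
  shows "\<phi> = 0"
proof -
  define M where "M = {u. \<forall>x\<in>carrier G. cinner (\<pi> x u) \<phi> = 0}"
  have "csubspace M"
    unfolding csubspace_def M_def
    by (simp add: unitary_repr_add unitary_repr_scaleC unitary_repr_zero cinner_add_left
        cinner_scaleC_left)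
  moreover have "closed M"
  proof -
    have "M = (\<Inter>x\<in>carrier G. {u. cinner (\<pi> x u) \<phi> = 0})"
      unfolding M_def by blast
    moreover have "closed {u. cinner (\<pi> x u) \<phi> = 0}" if "x \<in> carrier G" for x
      using that
      by (intro closed_Collect_eq continuous_on_cinner_left unitary_repr_continuous_vector
          continuous_on_const)
    ultimately show ?thesis by (simp add: closed_INT)
  qed
  \<comment> \<open>Applying \<open>\<pi> x\<close> to the vector right-translates its transform by
    \<open>x\<close>, which preserves vanishing.\<close>
  moreover have "\<pi> x ` M \<subseteq> M" if x: "x \<in> carrier G" for x
  proof (clarsimp simp: M_def)
    fix u y
    assume u: "\<forall>x\<in>carrier G. cinner (\<pi> x u) \<phi> = 0" and y: "y \<in> carrier G"
    have "y \<otimes> x \<in> carrier G"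
      using x y grp by (simp add: group.is_monoid monoid.m_closed)
    with u have "cinner (\<pi> (y \<otimes> x) u) \<phi> = 0" by blast
    then show "cinner (\<pi> y (\<pi> x u)) \<phi> = 0"
      by (simp add: unitary_repr_mult[OF y x])
  qed
  ultimately have "M = {0} \<or> M = UNIV"
    using irred unfolding irreducible_representation_def by blast
  moreover have "\<psi> \<in> M"
    using zero by (simp add: M_def wavelet_eq)
  ultimately have "\<phi> \<in> M"
    using \<open>\<psi> \<noteq> 0\<close> by blast
  moreover have "\<one> \<in> carrier G"
    using grp by (simp add: group.is_monoid)
  \<comment> \<open>At the identity the transform of \<open>\<phi>\<close> with window
    \<open>\<phi>\<close> is the squared norm of \<open>\<phi>\<close>.\<close>
  ultimately have "cinner (\<pi> \<one> \<phi>) \<phi> = 0"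
    unfolding M_def by blast
  then show ?thesis
    by (simp add: unitary_repr_one)
qed

end


section \<open>Haar measure and continuous functions\<close>

text \<open>If \<open>U\<close> were null, so would be all its right translates. They cover the
  group, and by second countability countably many suffice, so the whole group would be
  null.\<close>

lemma (in lie_group) right_haar_measure_open_nonnull:
  assumes haar: "right_haar_measure G (carrier G) M" and U: "open U" "U \<noteq> {}"
  shows "emeasure M U \<noteq> 0"
proof
  assume null: "emeasure M U = 0"
  have carrier [simp]: "x \<in> carrier G" for x
    by (simp add: carrier_UNIV)
  have sets: "sets M = sets borel" and univ: "emeasure M UNIV \<noteq> 0"
    and invariant: "\<And>g A. A \<in> sets M \<Longrightarrow> emeasure M ((\<lambda>x. x \<otimes> g) ` A) = emeasure M A"
    using haar unfolding right_haar_measure_def by (auto simp: carrier_UNIV)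
  define \<F> where "\<F> = range (\<lambda>g. (\<lambda>x. x \<otimes> g) ` U)"
  have translate: "open ((\<lambda>x. x \<otimes> g) ` U)" for g
  proof -
    \<comment> \<open>Written as a preimage under translation by the inverse, the translate is open
      by continuity of multiplication.\<close>
    have "(\<lambda>x. x \<otimes> g) ` U = (\<lambda>x. x \<otimes> inv g) -` U"
    proof (intro equalityI subsetI)
      fix y assume "y \<in> (\<lambda>x. x \<otimes> g) ` U"
      then show "y \<in> (\<lambda>x. x \<otimes> inv g) -` U" by (auto simp: m_assoc)
    next
      fix y assume "y \<in> (\<lambda>x. x \<otimes> inv g) -` U"
      then have "y = (y \<otimes> inv g) \<otimes> g" "y \<otimes> inv g \<in> U" by (auto simp: m_assoc)
      then show "y \<in> (\<lambda>x. x \<otimes> g) ` U" by (rule image_eqI)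
    qed
    moreover have "continuous_on UNIV (\<lambda>x. x \<otimes> inv g)"
      using continuous_on_compose2[OF mult_continuous, of UNIV "\<lambda>x. (x, inv g)"]
      by (simp add: continuous_on_Pair continuous_on_id)
    ultimately show ?thesis
      using U(1) by (simp add: open_vimage)
  qed
  then have "open S" if "S \<in> \<F>" for S
    using that unfolding \<F>_def by (elim rangeE) simp
  then obtain \<F>' where \<F>': "\<F>' \<subseteq> \<F>" "countable \<F>'" "\<Union>\<F>' = \<Union>\<F>"
    by (rule Lindelof)
  have "A \<in> null_sets M" if A: "A \<in> \<F>'" for A
  proof -
    obtain g where g: "A = (\<lambda>x. x \<otimes> g) ` U"
      using A \<F>'(1) unfolding \<F>_def by blast
    have "emeasure M A = 0" "A \<in> sets M"
      using invariant[of U g] null U(1) translate[of g] unfolding g sets by simp_all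
    then show ?thesis by (rule null_setsI)
  qed
  then have "(\<Union>A\<in>\<F>'. A) \<in> null_sets M"
    using \<F>'(2) by (intro null_sets_UN')
  moreover have "\<Union>\<F> = UNIV"
  proof -
    obtain u where u: "u \<in> U" using U(2) by blast
    \<comment> \<open>This puts \<open>y\<close> in the translate of \<open>U\<close> by
      \<open>inv u \<otimes> y\<close>.\<close>
    have "y = u \<otimes> (inv u \<otimes> y)" for y
      by (simp flip: m_assoc)
    then show ?thesis
      using u unfolding \<F>_def by blast
  qed
  ultimately show False
    using univ \<F>'(3) by (simp add: null_sets_def)
qed

text \<open>The set where \<open>f\<close> is nonzero is open and null, hence empty.\<close>

lemma (in lie_group) continuous_null_imp_zero:
  fixes f :: "'a \<Rightarrow> complex"
  assumes haar: "right_haar_measure G (carrier G) M" and cont: "continuous_on UNIV f"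
    and AE: "AE x in M. f x = 0"
  shows "f x = 0"
proof -
  have op: "open {x. f x \<noteq> 0}"
    by (intro open_Collect_neq cont continuous_on_const)
  have "sets M = sets borel" "space M = UNIV"
    using haar unfolding right_haar_measure_def by (auto simp: carrier_UNIV)
  then have "emeasure M {x. f x \<noteq> 0} = 0"
    using AE op by (subst (asm) AE_iff_measurable[where N = "{x. f x \<noteq> 0}"]) auto
  then have "{x. f x \<noteq> 0} = {}"
    using right_haar_measure_open_nonnull[OF haar op] by blast
  then show ?thesis by blast
qed

section \<open>Comparison of the ranges of two wavelet transforms\<close>

text \<open>A scalar on the window moves to the analysed vector as its conjugate. For
  \<open>c \<noteq> 0\<close>, a second application with \<open>inverse c\<close> gives the reverse
  inclusion.\<close>

lemma range_wavelet_scaleC_subset: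
  fixes \<phi> :: "'h::complex_hilbert"
  assumes "group G" "unitary_representation G \<pi>" "carrier G = UNIV"
  shows "range (wavelet \<pi> (c *\<^sub>C \<phi>)) \<subseteq> range (wavelet \<pi> \<phi>)"
proof -
  have "wavelet \<pi> (c *\<^sub>C \<phi>) \<psi> = wavelet \<pi> \<phi> (cnj c *\<^sub>C \<psi>)" for \<psi>
    using assms(3)
    by (simp add: fun_eq_iff wavelet_eq[OF assms(1,2)] unitary_repr_scaleC[OF assms(1,2)]
        cinner_scaleC_left cinner_scaleC_right)
  then show ?thesis by blast
qed

lemma (in lie_group) wavelet_eq_imp_proportional:
  assumes haar: "right_haar_measure G (carrier G) \<mu>"
    and unitary: "unitary_representation G \<pi>" and irred: "irreducible_representation G \<pi>"
    and dm: "duflo_moore_operator \<mu> \<pi> Dom T" and Dom: "\<phi>1 \<in> Dom" "\<phi>2 \<in> Dom"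
    and eq: "wavelet \<pi> \<phi>1 \<psi>1 = wavelet \<pi> \<phi>2 \<psi>2"
    and nonzero: "wavelet \<pi> \<phi>1 \<psi>1 \<noteq> (\<lambda>x. 0)"
  shows "\<exists>c. c \<noteq> 0 \<and> \<phi>1 = c *\<^sub>C \<phi>2"
proof -
  note grp = is_group
  have carrier [simp]: "x \<in> carrier G" for x
    by (simp add: carrier_UNIV)
  note W = wavelet_eq[OF grp unitary carrier]
  have L2: "in_L2 \<mu> (wavelet \<pi> \<phi>1 \<psi>1)"
    using dm Dom unfolding duflo_moore_operator_def by blast
  have orth: "L2_inner \<mu> (wavelet \<pi> \<phi> \<psi>) (wavelet \<pi> \<phi>1 \<psi>') =
      cinner \<psi> \<psi>' * cnj (cinner (T \<phi>) (T \<phi>1))" if "\<phi> \<in> Dom" for \<phi> \<psi> \<psi>'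
    using dm Dom that unfolding duflo_moore_operator_def by blast
  \<comment> \<open>\<open>k\<close> and \<open>d\<close> are the factors that the orthogonality
    relation yields when the common function, written with window \<open>\<phi>1\<close> or
    \<open>\<phi>2\<close>, is paired with a transform of window \<open>\<phi>1\<close>;
    \<open>k\<close> is the squared norm of \<open>T \<phi>1\<close>.\<close>
  define k where "k = cnj (cinner (T \<phi>1) (T \<phi>1))"
  define d where "d = cnj (cinner (T \<phi>2) (T \<phi>1))"
  \<comment> \<open>Otherwise the common function has zero \<open>L2\<close> norm, so it vanishes
    almost everywhere and, being continuous, everywhere.\<close>
  have "k \<noteq> 0"
  proof
    assume "k = 0"
    then have "L2_inner \<mu> (wavelet \<pi> \<phi>1 \<psi>1) (wavelet \<pi> \<phi>1 \<psi>1) = 0"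
      by (simp add: orth Dom k_def)
    then have "complex_of_real (LINT x|\<mu>. (cmod (wavelet \<pi> \<phi>1 \<psi>1 x))\<^sup>2) = 0"
      unfolding L2_inner_def complex_norm_square[symmetric] integral_complex_of_real .
    then have "AE x in \<mu>. (cmod (wavelet \<pi> \<phi>1 \<psi>1 x))\<^sup>2 = 0"
      using L2 unfolding in_L2_def by (subst (asm) of_real_eq_0_iff)
        (simp add: integral_nonneg_eq_0_iff_AE)
    then have "AE x in \<mu>. wavelet \<pi> \<phi>1 \<psi>1 x = 0" by simp
    then have "wavelet \<pi> \<phi>1 \<psi>1 x = 0" for x
      using continuous_null_imp_zero[OF haar] wavelet_continuous[OF grp unitary]
      unfolding carrier_UNIV by blast
    with nonzero show False by blast
  qed
  \<comment> \<open>Both sides evaluate the same \<open>L2\<close> inner product.\<close>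
  have "cinner (k *\<^sub>C \<psi>1) \<psi> = cinner (d *\<^sub>C \<psi>2) \<psi>" for \<psi>
    using orth[OF Dom(1), of \<psi>1 \<psi>] orth[OF Dom(2), of \<psi>2 \<psi>]
    by (simp add: eq k_def d_def cinner_scaleC_left mult.commute)
  then have "k *\<^sub>C \<psi>1 = d *\<^sub>C \<psi>2"
    by (rule cinner_eqI_left)
  then have "(inverse k * k) *\<^sub>C \<psi>1 = (inverse k * d) *\<^sub>C \<psi>2"
    by (metis scaleC_scaleC)
  then obtain a where a: "\<psi>1 = a *\<^sub>C \<psi>2"
    using \<open>k \<noteq> 0\<close> by auto
  \<comment> \<open>Either being zero would make the common function the transform of the zero
    vector.\<close>
  have "a \<noteq> 0" "\<psi>2 \<noteq> 0"
    using nonzero eq a by (auto simp: W fun_eq_iff unitary_repr_zero[OF grp unitary])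
  \<comment> \<open>The conjugate on the window restores \<open>a\<close> on \<open>\<psi>2\<close>:
    the transform of \<open>\<psi>2\<close> with window \<open>cnj a *\<^sub>C \<phi>1\<close> is
    that of \<open>\<psi>1\<close> with window \<open>\<phi>1\<close>.\<close>
  have "wavelet \<pi> (cnj a *\<^sub>C \<phi>1 - \<phi>2) \<psi>2 x = 0" for x
    using fun_cong[OF eq, of x]
    by (simp add: W a unitary_repr_scaleC[OF grp unitary] cinner_scaleC_left cinner_scaleC_right
        cinner_diff_right)
  then have "cnj a *\<^sub>C \<phi>1 - \<phi>2 = 0"
    using irreducible_wavelet_eq_0[OF grp unitary irred] \<open>\<psi>2 \<noteq> 0\<close> by blast
  then have "inverse (cnj a) *\<^sub>C \<phi>2 = (inverse (cnj a) * cnj a) *\<^sub>C \<phi>1"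
    by (simp flip: scaleC_scaleC)
  then have "\<phi>1 = inverse (cnj a) *\<^sub>C \<phi>2"
    using \<open>a \<noteq> 0\<close> by simp
  then show ?thesis
    using \<open>a \<noteq> 0\<close> by (intro exI[of _ "inverse (cnj a)"]) simp
qed

text \<open>Proportionality is taken with \<open>c \<noteq> 0\<close>: if the first window is zero
  and the second is not, the first range is trivial and the second is not, so that case belongs to
  the second alternative.\<close>

theorem proposition5p5:
  fixes G :: "('a::{t2_space, second_countable_topology}, 'b::real_normed_vector, 'm)
                lie_group_data_scheme"
    and F :: "'b \<Rightarrow> real"
    and \<mu>\<^sub>r :: "'a measure"
    and \<pi> :: "'a \<Rightarrow> 'h::complex_hilbert \<Rightarrow> 'h"
    and Dom :: "'h set" and T :: "'h \<Rightarrow> 'h"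
    and \<phi>\<^sub>1 \<phi>\<^sub>2 :: 'h
  assumes "connected_exponential_lie_group G"
    and "linear F"
    and "coadjoint_stabilizer G F = {\<one>\<^bsub>G\<^esub>}"
    and "right_haar_measure G (carrier G) \<mu>\<^sub>r"
    and "orbit_representation G \<mu>\<^sub>r F \<pi>"
    and "square_integrable_representation \<mu>\<^sub>r \<pi>"
    and "duflo_moore_operator \<mu>\<^sub>r \<pi> Dom T"
    and "\<phi>\<^sub>1 \<in> Dom" and "\<phi>\<^sub>2 \<in> Dom"
  shows "((\<exists>c. c \<noteq> 0 \<and> \<phi>\<^sub>1 = c *\<^sub>C \<phi>\<^sub>2) \<longrightarrow>
            range (wavelet \<pi> \<phi>\<^sub>1) = range (wavelet \<pi> \<phi>\<^sub>2)) \<and>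
         (\<not> (\<exists>c. c \<noteq> 0 \<and> \<phi>\<^sub>1 = c *\<^sub>C \<phi>\<^sub>2) \<longrightarrow>
            range (wavelet \<pi> \<phi>\<^sub>1) \<inter> range (wavelet \<pi> \<phi>\<^sub>2) = {\<lambda>x. 0})"
proof -
  interpret connected_exponential_lie_group G by fact
  have unitary: "unitary_representation G \<pi>" and irred: "irreducible_representation G \<pi>"
    using assms(5) unfolding orbit_representation_def by auto
  note subset = range_wavelet_scaleC_subset[OF is_group unitary carrier_UNIV]
  have "range (wavelet \<pi> \<phi>\<^sub>1) = range (wavelet \<pi> \<phi>\<^sub>2)" if "c \<noteq> 0" "\<phi>\<^sub>1 = c *\<^sub>C \<phi>\<^sub>2" for c
  proof -
    have "\<phi>\<^sub>2 = inverse c *\<^sub>C \<phi>\<^sub>1"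
      using that by (simp add: scaleC_scaleC)
    then show ?thesis
      using subset[of c \<phi>\<^sub>2] subset[of "inverse c" \<phi>\<^sub>1] that by auto
  qed
  moreover have "range (wavelet \<pi> \<phi>\<^sub>1) \<inter> range (wavelet \<pi> \<phi>\<^sub>2) = {\<lambda>x. 0}"
    if "\<not> (\<exists>c. c \<noteq> 0 \<and> \<phi>\<^sub>1 = c *\<^sub>C \<phi>\<^sub>2)"
  proof -
    have "wavelet \<pi> \<phi> 0 = (\<lambda>x. 0)" for \<phi>
      by (simp add: wavelet_def)
    then have "(\<lambda>x. 0) \<in> range (wavelet \<pi> \<phi>)" for \<phi>
      by (metis rangeI)
    moreover have "f = (\<lambda>x. 0)" if "f \<in> range (wavelet \<pi> \<phi>\<^sub>1) \<inter> range (wavelet \<pi> \<phi>\<^sub>2)" for f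
      using that \<open>\<not> (\<exists>c. c \<noteq> 0 \<and> \<phi>\<^sub>1 = c *\<^sub>C \<phi>\<^sub>2)\<close>
        wavelet_eq_imp_proportional[OF assms(4) unitary irred assms(7-9)]
      by blast
    ultimately show ?thesis by blast
  qed
  ultimately show ?thesis by blast
qed

end
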